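(* Let $r \in \mathbb{Q}_{>0}$ with $r<1$, let $S = \{s_0 = 0 < s_1 < s_2 < \cdots\} \subseteq \mathbb{N}_0$ be infinite, let $\delta_n = s_{n+1}-s_n$ for $n \in \mathbb{N}_0$, and let $M_{r,S} = \langle r^{s_n} \mid n \in \mathbb{N}_0 \rangle$ be the additive submonoid of $\mathbb{Q}_{\geq 0}$ generated by the powers $r^{s_n}$. Suppose that $M_{r,S}$ is atomic. If $M_{r,S}$ satisfies the ACCP, then $$\mathsf{d}(r) \leq \mathsf{n}(r)\cdot \limsup_{n \to\infty} \sqrt[s_n]{\mathsf{n}(r)^{\delta_n}},$$ where the limit superior is allowed to be $+\infty$.
   Context: For $r \in \mathbb{Q}_{>0}$ write $r = \mathsf{n}(r)/\mathsf{d}(r)$ with $\mathsf{n}(r), \mathsf{d}(r)$ relatively prime positive integers. The $s_n$-th root is considered for $n \geq 1$ (where $s_n>0$). For an additive commutative, cancellative, reduced monoid $M$: an atom is a nonzero $a \in M$ such that $a=x+y$ with $x,y\in M$ implies $x=0$ or $y=0$; $M$ is atomic if it is generated by its atoms; a principal ideal is a set $x+M$ with $x \in M$; and $M$ satisfies the ACCP if every increasing sequence of principal ideals of $M$ eventually stabilizes. *)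

theory Defs
  imports Complex_Main "HOL-Library.Extended_Real"
begin

text \<open>The components of \<^const>\<open>quotient_of\<close> are coprime, and the second one is positive.\<close>

definition numer :: "rat \<Rightarrow> int" where
  "numer r = fst (quotient_of r)"

definition denom :: "rat \<Rightarrow> int" where
  "denom r = snd (quotient_of r)"

inductive_set generated_monoid :: "'a::comm_monoid_add set \<Rightarrow> 'a set"
  for A :: "'a set" where
  zero: "0 \<in> generated_monoid A"
| gen: "a \<in> A \<Longrightarrow> a \<in> generated_monoid A"
| add: "x \<in> generated_monoid A \<Longrightarrow> y \<in> generated_monoid A \<Longrightarrow> x + y \<in> generated_monoid A"

text \<open>
  The notions below are meant for submonoids \<open>M\<close> of the ambient additive monoid
  (in the application, of the nonnegative rationals) that are cancellative and reduced, so
  that \<open>0\<close> is the only invertible element.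
\<close>

definition monoid_atoms :: "'a::comm_monoid_add set \<Rightarrow> 'a set" where
  "monoid_atoms M = {a \<in> M. a \<noteq> 0 \<and> (\<forall>x\<in>M. \<forall>y\<in>M. a = x + y \<longrightarrow> x = 0 \<or> y = 0)}"

definition atomic_monoid :: "'a::comm_monoid_add set \<Rightarrow> bool" where
  "atomic_monoid M \<longleftrightarrow> M = generated_monoid (monoid_atoms M)"

definition principal_ideals :: "'a::comm_monoid_add set \<Rightarrow> 'a set set" where
  "principal_ideals M = {{x + m | m. m \<in> M} | x. x \<in> M}"

definition accp :: "'a::comm_monoid_add set \<Rightarrow> bool" where
  "accp M \<longleftrightarrow>
     (\<forall>I :: nat \<Rightarrow> 'a set. (\<forall>n. I n \<in> principal_ideals M) \<and> (\<forall>n. I n \<subseteq> I (Suc n))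
        \<longrightarrow> (\<exists>N. \<forall>n\<ge>N. I n = I N))"

definition power_monoid :: "rat \<Rightarrow> nat set \<Rightarrow> rat set" where
  "power_monoid r S = generated_monoid {r ^ k | k. k \<in> S}"

end

theory Submission
  imports Defs
begin

text \<open>
  Write \<open>r = a / b\<close> and suppose that \<open>a L < b\<close>, where \<open>L\<close> is the limit superior.
  Then the terms \<open>a ^ \<delta> n * r ^ s n\<close> are eventually dominated by \<open>t ^ s n\<close> for some \<open>t < 1\<close>,
  so they are summable. Since \<open>a ^ \<delta> n * r ^ s n = b ^ \<delta> n * r ^ s (Suc n)\<close>, an element
  \<open>c * r ^ s n\<close> with \<open>c > 0\<close> can be written as \<open>c' * r ^ s (Suc n)\<close> plus between \<open>1\<close> and
  \<open>a ^ \<delta> n\<close> copies of \<open>r ^ s n\<close>. Starting with an integer larger than the sum of the series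
  and iterating, the coefficient stays positive, which gives an infinite strictly descending
  sequence of divisors and contradicts the ACCP.
\<close>

lemma generated_monoid_of_nat_mult:
  fixes a :: "'a::semiring_1"
  assumes "a \<in> generated_monoid A"
  shows "of_nat k * a \<in> generated_monoid A"
  by (induction k) (auto simp: distrib_right intro: generated_monoid.intros assms)

lemma generated_monoid_nonneg:
  fixes A :: "'a::ordered_comm_monoid_add set"
  assumes "\<And>a. a \<in> A \<Longrightarrow> 0 \<le> a" and "x \<in> generated_monoid A"
  shows "0 \<le> x"
  using assms(2) by induction (auto simp: assms(1))

text \<open>Since consecutive differences lie in the monoid, the ideals generated by the
  \<open>x n\<close> increase. If they stabilized at \<open>N\<close>, then \<open>x (Suc N)\<close>
  would be \<open>x N\<close> plus a nonnegative element, against the strict decrease.\<close>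

lemma not_accp_if_decreasing:
  fixes x :: "nat \<Rightarrow> 'a::linordered_ab_group_add"
  assumes nonneg: "\<And>a. a \<in> A \<Longrightarrow> 0 \<le> a"
    and x: "\<And>n. x n \<in> generated_monoid A"
    and diff: "\<And>n. x n - x (Suc n) \<in> generated_monoid A"
    and less: "\<And>n. x (Suc n) < x n"
  shows "\<not> accp (generated_monoid A)"
proof
  let ?M = "generated_monoid A"
  define I where "I n = {x n + m | m. m \<in> ?M}" for n
  assume "accp ?M"
  moreover have "I n \<in> principal_ideals ?M" for n
    using x by (auto simp: I_def principal_ideals_def)
  moreover have "I n \<subseteq> I (Suc n)" for n
  proof
    fix y assume "y \<in> I n"
    then obtain m where "m \<in> ?M" and y: "y = x n + m"
      by (auto simp: I_def)
    then have "(x n - x (Suc n)) + m \<in> ?M"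
      using diff generated_monoid.add by blast
    moreover have "y = x (Suc n) + ((x n - x (Suc n)) + m)"
      by (simp add: y)
    ultimately show "y \<in> I (Suc n)"
      unfolding I_def by blast
  qed
  ultimately obtain N where N: "\<And>n. n \<ge> N \<Longrightarrow> I n = I N"
    unfolding accp_def by blast
  have "x (Suc N) + 0 \<in> I (Suc N)"
    unfolding I_def using generated_monoid.zero by blast
  then have "x (Suc N) \<in> I N"
    using N[of "Suc N"] by simp
  then obtain m where "m \<in> ?M" and "x (Suc N) = x N + m"
    by (auto simp: I_def)
  moreover from this have "0 \<le> m"
    using generated_monoid_nonneg nonneg by blast
  ultimately show False
    using less[of N] by simp
qed

lemma not_accp_power_monoid_if_summable:
  fixes a b :: nat and s :: "nat \<Rightarrow> nat" and r :: rat
  assumes a: "0 < a" and b: "0 < b" and r: "r = of_nat a / of_nat b"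
    and mono: "mono s"
    and summable: "summable (\<lambda>n. real a ^ (s (Suc n) - s n) * of_rat r ^ s n)"
  shows "\<not> accp (power_monoid r (range s))"
proof -
  let ?d = "\<lambda>n. s (Suc n) - s n"
  define f where "f n = real a ^ ?d n * of_rat r ^ s n" for n
  \<comment> \<open>The factor \<open>r ^ s 0\<close> stays because only monotonicity of
    \<open>s\<close> is assumed here.\<close>
  obtain c0 :: nat where c0: "suminf f < of_rat (of_nat c0 * r ^ s 0)"
  proof -
    obtain k :: nat where "suminf f / of_rat (r ^ s 0) < k"
      using reals_Archimedean2 by blast
    then show ?thesis
      using that[of k] a b by (simp add: r divide_less_eq of_rat_mult of_rat_divide of_rat_power)
  qed
  \<comment> \<open>Subtracting \<open>1\<close> before dividing makes the decrease strict even when \<open>a ^ \<delta> n\<close> divides \<open>c n\<close>.\<close>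
  define c where "c = rec_nat c0 (\<lambda>n k. b ^ ?d n * ((k - 1) div a ^ ?d n))"
  define e where "e n = Suc ((c n - 1) mod a ^ ?d n)" for n
  define x where "x n = of_nat (c n) * r ^ s n" for n
  have c_Suc: "c (Suc n) = b ^ ?d n * ((c n - 1) div a ^ ?d n)" for n
    by (simp add: c_def)
  have r_pos: "0 < r"
    using a b by (simp add: r)
  have step: "x n - x (Suc n) = of_nat (e n) * r ^ s n" if "0 < c n" for n
  proof -
    \<comment> \<open>This identity trades \<open>a ^ ?d n\<close> copies of \<open>r ^ s n\<close>
      for \<open>b ^ ?d n\<close> copies of \<open>r ^ s (Suc n)\<close>.\<close>
    have "of_nat b ^ ?d n * r ^ ?d n = of_nat a ^ ?d n"
      using b by (simp add: r power_divide)
    moreover have "r ^ s (Suc n) = r ^ ?d n * r ^ s n"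
      using monoD[OF mono, of n "Suc n"] by (simp flip: power_add)
    ultimately have "x (Suc n) = of_nat ((c n - 1) div a ^ ?d n * a ^ ?d n) * r ^ s n"
      by (simp add: x_def c_Suc)
    moreover have "c n = (c n - 1) div a ^ ?d n * a ^ ?d n + e n"
      using that div_mult_mod_eq[of "c n - 1" "a ^ ?d n"] unfolding e_def by linarith
    then have "x n = of_nat ((c n - 1) div a ^ ?d n * a ^ ?d n + e n) * r ^ s n"
      by (simp add: x_def)
    ultimately show ?thesis
      by (simp add: algebra_simps)
  qed
  have e_le: "e n \<le> a ^ ?d n" for n
    using a by (simp add: e_def Suc_le_eq)
  have partial_sum_le: "sum f {..<n} \<le> suminf f" for n
    using summable r_pos unfolding f_def[abs_def] by (intro sum_le_suminf) auto
  \<comment> \<open>Invariant: \<open>x n\<close> exceeds the tail of the series from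
    \<open>n\<close> on. It yields \<open>0 < c n\<close>, which \<open>step\<close> requires
    because \<open>c n - 1\<close> is truncated subtraction.\<close>
  have bound: "suminf f < of_rat (x n) + sum f {..<n}" for n
  proof (induction n)
    case 0
    then show ?case
      using c0 by (simp add: x_def c_def)
  next
    case (Suc n)
    have "0 < real_of_rat (x n)"
      using Suc.IH partial_sum_le[of n] by linarith
    then have "0 < c n"
      by (auto simp: x_def intro: gr0I)
    from step[OF this] have "of_rat (x n) - of_rat (x (Suc n)) = real (e n) * of_rat r ^ s n"
      by (metis of_rat_diff of_rat_mult of_rat_of_nat_eq of_rat_power)
    also have "\<dots> \<le> f n"
      unfolding f_def using e_le[of n] r_pos
      by (intro mult_right_mono) (auto simp flip: of_nat_power)
    finally show ?case
      using Suc.IH by simp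
  qed
  have c_pos: "0 < c n" for n
  proof (rule gr0I)
    assume "c n = 0"
    then show False
      using bound[of n] partial_sum_le[of n] by (simp add: x_def)
  qed
  let ?A = "{r ^ k | k. k \<in> range s}"
  have multiples: "of_nat k * r ^ s n \<in> generated_monoid ?A" for k n
    by (intro generated_monoid_of_nat_mult generated_monoid.gen) auto
  have "\<not> accp (generated_monoid ?A)"
  proof (rule not_accp_if_decreasing)
    show "0 \<le> y" if "y \<in> ?A" for y
      using that r_pos by auto
    show "x n \<in> generated_monoid ?A" for n
      unfolding x_def by (rule multiples)
    show "x n - x (Suc n) \<in> generated_monoid ?A" for n
      unfolding step[OF c_pos] by (rule multiples)
    have "0 < x n - x (Suc n)" for n
      unfolding step[OF c_pos] using r_pos by (simp add: e_def del: of_nat_Suc)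
    then show "x (Suc n) < x n" for n
      by simp
  qed
  then show ?thesis
    by (simp add: power_monoid_def)
qed

text \<open>Root test along \<open>s\<close>: for \<open>y\<close> between the limit superior and
  \<open>1 / q\<close>, the terms are eventually at most \<open>(y * q) ^ s n\<close>, hence at most
  \<open>(y * q) ^ n\<close>.\<close>

lemma summable_if_limsup_root_less:
  fixes g :: "nat \<Rightarrow> real" and q :: real and s :: "nat \<Rightarrow> nat"
  assumes g: "\<And>n. 0 \<le> g n" and q: "0 < q" and s: "strict_mono s"
    and limsup: "limsup (\<lambda>n. ereal (root (s n) (g n))) < ereal (1 / q)"
  shows "summable (\<lambda>n. g n * q ^ s n)"
proof -
  obtain y where y: "limsup (\<lambda>n. ereal (root (s n) (g n))) < ereal y" "y < 1 / q"
    using ereal_dense2[OF limsup] by auto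
  \<comment> \<open>With \<open>n > 0\<close> also \<open>s n > 0\<close>; this avoids the default
    value \<open>root 0 x = 0\<close>.\<close>
  have ev: "eventually (\<lambda>n. n > 0 \<and> root (s n) (g n) < y) sequentially"
    using Limsup_lessD[OF y(1)] eventually_gt_at_top[of 0] by eventually_elim simp
  then obtain n0 where "root (s n0) (g n0) < y"
    using eventually_happens'[OF sequentially_bot ev] by blast
  then have y_pos: "0 < y"
    using real_root_ge_zero[OF g, of "s n0" n0] by linarith
  have yq: "y * q < 1"
    using y(2) q by (simp add: field_simps)
  from ev have "eventually (\<lambda>n. norm (g n * q ^ s n) \<le> (y * q) ^ n) sequentially"
  proof eventually_elim
    case (elim n)
    have "n \<le> s n"
      using s by (rule strict_mono_imp_increasing)
    with elim have "g n = root (s n) (g n) ^ s n"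
      by (simp add: g)
    also have "\<dots> \<le> y ^ s n"
      using elim g by (intro power_mono) (auto intro: real_root_ge_zero)
    finally have "g n * q ^ s n \<le> (y * q) ^ s n"
      using q by (simp add: power_mult_distrib)
    also have "\<dots> \<le> (y * q) ^ n"
      using yq y_pos q \<open>n \<le> s n\<close> by (intro power_decreasing) auto
    finally show ?case
      using g q by simp
  qed
  moreover have "summable (\<lambda>n. (y * q) ^ n)"
    using yq y_pos q by (intro summable_geometric) simp
  ultimately show ?thesis
    by (rule summable_comparison_test_ev)
qed

theorem proposition4p1:
  fixes r :: rat and S :: "nat set" and s \<delta> :: "nat \<Rightarrow> nat"
  assumes "0 < r" and "r < 1"
    and "strict_mono s" and "s 0 = 0" and "S = range s"
    and "\<And>n. \<delta> n = s (Suc n) - s n"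
    and "atomic_monoid (power_monoid r S)"
    and "accp (power_monoid r S)"
  shows "ereal (real_of_int (denom r))
         \<le> ereal (real_of_int (numer r))
            * limsup (\<lambda>n. ereal (root (s n) (real_of_int (numer r) ^ \<delta> n)))"
proof (rule ccontr)
  let ?L = "limsup (\<lambda>n. ereal (root (s n) (real_of_int (numer r) ^ \<delta> n)))"
  assume contr: "\<not> ?thesis"
  have quot: "quotient_of r = (numer r, denom r)"
    by (simp add: numer_def denom_def)
  have denom: "0 < denom r"
    using quotient_of_denom_pos[OF quot] .
  have r: "r = of_int (numer r) / of_int (denom r)"
    using quotient_of_div[OF quot] .
  have numer: "0 < numer r"
    using \<open>0 < r\<close> denom by (subst (asm) r) (simp add: zero_less_divide_iff)
  obtain a b where ab: "numer r = int a" "denom r = int b"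
    using numer denom by (metis less_imp_le nonneg_int_cases)
  have a: "0 < a" and b: "0 < b"
    using numer denom ab by simp_all
  have r_ab: "r = of_nat a / of_nat b"
    using r ab by simp
  then have r_real: "real_of_rat r = a / b"
    by (simp add: of_rat_divide)
  have "ereal a * ?L < ereal b"
    using contr ab by (simp add: not_le)
  then have "?L < ereal (1 / of_rat r)"
    \<comment> \<open>As \<open>a\<close> is positive, \<open>?L = \<infinity>\<close> would make
      the product infinite; for finite \<open>?L\<close> one divides by \<open>a\<close>.\<close>
    using a by (cases ?L) (auto simp: r_real field_simps)
  then have "summable (\<lambda>n. real a ^ \<delta> n * of_rat r ^ s n)"
    using ab \<open>0 < r\<close> by (intro summable_if_limsup_root_less \<open>strict_mono s\<close>) auto
  then have "\<not> accp (power_monoid r (range s))"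
    using assms(6) by (intro not_accp_power_monoid_if_summable[OF a b r_ab])
      (simp_all add: strict_mono_mono \<open>strict_mono s\<close>)
  then show False
    using assms(5,8) by simp
qed

end
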